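(* Let $\alpha,\beta\in IF_n$. Then the following statements are equivalent: (i) $\alpha\,\mathcal{J}\,\beta$, where $\mathcal J$ is Green's $\mathcal J$-relation on the semigroup $IF_n$. (ii) $|\alpha(k)|=|\beta(k)|$ and $|\alpha^{o}(2k+1)|=|\beta^{o}(2k+1)|$ for all $k\in\mathbb{N}$.
   Context: $\mathbb N=\{1,2,3,\dots\}$, $n\in\mathbb N$. $X_n=\{a_1,\dots,a_n\}$ is an $n$-element set with the fence (zigzag) partial order $<_f$ given by $a_1<_f a_2>_f a_3<_f\cdots a_n$ (up-fence: the only strict relations are between consecutively indexed elements, odd-indexed elements are minimal, even-indexed elements are maximal). $I_n$ is the symmetric inverse semigroup of all partial injective maps on $X_n$; maps are written on the right and composed left to right. $IF_n$ is the inverse subsemigroup of all $\alpha\in I_n$ such that for all $x,y\in\mathrm{dom}\,\alpha$: $x<_f y$ if and only if $x\alpha<_f y\alpha$. For $Y\subseteq X_n$, $Y_S$ denotes the set of all subsets of $Y$ of the form $\{a_i,a_{i+1},\dots,a_{i+r}\}$ with $1\le i\le n$, $r\ge 0$, $i+r\le n$, such that ($i=1$ or $a_{i-1}\notin Y$) and ($i+r=n$ or $a_{i+r+1}\notin Y$); i.e. the maximal blocks of consecutive elements of $Y$ (singletons allowed). For $\alpha\in IF_n$ and $k\in\mathbb N$: $\alpha(k):=\{A\in(\mathrm{dom}\,\alpha)_S: |A|=k\}$, and $\alpha^{o}(2k+1):=\{\{a_i,\dots,a_{i+2k}\}\in\alpha(2k+1): i \text{ odd}\}$. *)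

theory Defs
  imports Main
begin

text \<open>Green's relation J for a semigroup with carrier \<open>S\<close> and multiplication \<open>m\<close>:
  two elements are related iff they generate the same principal two-sided ideal.
  The four parts below are the expansion of \<open>S\<^sup>1 a S\<^sup>1\<close>, where \<open>S\<^sup>1\<close> is \<open>S\<close> with an
  identity adjoined if necessary.\<close>

definition principal_ideal :: "'a set \<Rightarrow> ('a \<Rightarrow> 'a \<Rightarrow> 'a) \<Rightarrow> 'a \<Rightarrow> 'a set" where
  "principal_ideal S m a =
     {a} \<union> {m s a |s. s \<in> S} \<union> {m a t |t. t \<in> S} \<union> {m (m s a) t |s t. s \<in> S \<and> t \<in> S}"

definition green_J :: "'a set \<Rightarrow> ('a \<Rightarrow> 'a \<Rightarrow> 'a) \<Rightarrow> 'a \<Rightarrow> 'a \<Rightarrow> bool" where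
  "green_J S m a b \<longleftrightarrow> a \<in> S \<and> b \<in> S \<and> principal_ideal S m a = principal_ideal S m b"

text \<open>The element \<open>a\<^sub>i\<close> of the fence is represented by its index \<open>i\<close>.\<close>

definition fence :: "nat \<Rightarrow> nat set" where
  "fence n = {1..n}"

text \<open>The strict order \<open>a\<^sub>1 < a\<^sub>2 > a\<^sub>3 < \<dots>\<close>; on \<open>fence n\<close> it is the restriction of this
  relation.\<close>

definition fence_less :: "nat \<Rightarrow> nat \<Rightarrow> bool" where
  "fence_less x y \<longleftrightarrow> odd x \<and> (y = x + 1 \<or> x = y + 1)"

definition sym_inv :: "nat \<Rightarrow> (nat \<rightharpoonup> nat) set" where
  "sym_inv n = {\<alpha>. dom \<alpha> \<subseteq> fence n \<and> ran \<alpha> \<subseteq> fence n \<and> inj_on \<alpha> (dom \<alpha>)}"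

definition IF_semigroup :: "nat \<Rightarrow> (nat \<rightharpoonup> nat) set" where
  "IF_semigroup n = {\<alpha> \<in> sym_inv n. \<forall>x \<in> dom \<alpha>. \<forall>y \<in> dom \<alpha>.
     fence_less x y \<longleftrightarrow> fence_less (the (\<alpha> x)) (the (\<alpha> y))}"

text \<open>Maps are written on the right, so in the product \<open>\<alpha> \<beta>\<close> the map \<open>\<alpha>\<close> is applied first,
  whereas \<open>\<circ>\<^sub>m\<close> applies its right argument first.\<close>

definition pmult :: "(nat \<rightharpoonup> nat) \<Rightarrow> (nat \<rightharpoonup> nat) \<Rightarrow> (nat \<rightharpoonup> nat)" where
  "pmult \<alpha> \<beta> = \<beta> \<circ>\<^sub>m \<alpha>"

lemma pmult_assoc: "pmult (pmult \<alpha> \<beta>) \<gamma> = pmult \<alpha> (pmult \<beta> \<gamma>)"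
  by (auto simp: pmult_def map_comp_def fun_eq_iff split: option.splits)

lemma IF_semigroup_fence_less:
  assumes "\<alpha> \<in> IF_semigroup n" "\<alpha> x = Some u" "\<alpha> y = Some v"
  shows "fence_less x y \<longleftrightarrow> fence_less u v"
proof -
  have "x \<in> dom \<alpha>" "y \<in> dom \<alpha>" using assms by (simp_all add: dom_def)
  with assms(1) have "fence_less x y \<longleftrightarrow> fence_less (the (\<alpha> x)) (the (\<alpha> y))"
    unfolding IF_semigroup_def by blast
  with assms show ?thesis by simp
qed

lemma pmult_closed:
  assumes "\<alpha> \<in> IF_semigroup n" "\<beta> \<in> IF_semigroup n"
  shows "pmult \<alpha> \<beta> \<in> IF_semigroup n"
proof -
  have a: "dom \<alpha> \<subseteq> fence n" "inj_on \<alpha> (dom \<alpha>)"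
    and b: "ran \<beta> \<subseteq> fence n" "inj_on \<beta> (dom \<beta>)"
    using assms by (simp_all add: IF_semigroup_def sym_inv_def)
  have E: "\<exists>u. \<alpha> x = Some u \<and> \<beta> u = Some z" if "pmult \<alpha> \<beta> x = Some z" for x z
    using that by (simp add: pmult_def map_comp_Some_iff)
  have "dom (pmult \<alpha> \<beta>) \<subseteq> fence n"
  proof
    fix x assume "x \<in> dom (pmult \<alpha> \<beta>)"
    then obtain z where "pmult \<alpha> \<beta> x = Some z" by (auto simp: dom_def)
    then obtain u where "\<alpha> x = Some u" using E by metis
    then show "x \<in> fence n" using subsetD[OF a(1) domI] by simp
  qed
  moreover have "ran (pmult \<alpha> \<beta>) \<subseteq> fence n"
  proof
    fix z assume "z \<in> ran (pmult \<alpha> \<beta>)"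
    then obtain x where "pmult \<alpha> \<beta> x = Some z" by (auto simp: ran_def)
    then obtain u where "\<beta> u = Some z" using E by metis
    then show "z \<in> fence n" using b(1) ranI[of \<beta> u z] by (simp add: subset_iff)
  qed
  moreover have "inj_on (pmult \<alpha> \<beta>) (dom (pmult \<alpha> \<beta>))"
  proof (rule inj_onI)
    fix x y assume "x \<in> dom (pmult \<alpha> \<beta>)" and eq: "pmult \<alpha> \<beta> x = pmult \<alpha> \<beta> y"
    then obtain z where "pmult \<alpha> \<beta> x = Some z" "pmult \<alpha> \<beta> y = Some z" by (auto simp: dom_def)
    then obtain u v where uv: "\<alpha> x = Some u" "\<beta> u = Some z" "\<alpha> y = Some v" "\<beta> v = Some z"
      using E by metis
    have "u = v" using inj_onD[OF b(2), of u v] uv by (simp add: domI)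
    then show "x = y" using inj_onD[OF a(2), of x y] uv by (simp add: domI)
  qed
  moreover have "fence_less x y \<longleftrightarrow> fence_less (the (pmult \<alpha> \<beta> x)) (the (pmult \<alpha> \<beta> y))"
    if xy: "x \<in> dom (pmult \<alpha> \<beta>)" "y \<in> dom (pmult \<alpha> \<beta>)" for x y
  proof -
    obtain w z where wz: "pmult \<alpha> \<beta> x = Some w" "pmult \<alpha> \<beta> y = Some z"
      using xy by (auto simp: dom_def)
    then obtain u v where uv: "\<alpha> x = Some u" "\<beta> u = Some w" "\<alpha> y = Some v" "\<beta> v = Some z"
      using E by metis
    show ?thesis
      using IF_semigroup_fence_less[OF assms(1) uv(1,3)]
        IF_semigroup_fence_less[OF assms(2) uv(2,4)] wz by simp
  qed
  ultimately show ?thesis by (simp add: IF_semigroup_def sym_inv_def)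
qed

text \<open>The set \<open>Y\<^sub>S\<close>; it depends on \<open>n\<close> because indices range over \<open>1, \<dots>, n\<close>.\<close>

definition blocks :: "nat \<Rightarrow> nat set \<Rightarrow> nat set set" where
  "blocks n Y = {{i..i + r} |i r. 1 \<le> i \<and> i + r \<le> n \<and> {i..i + r} \<subseteq> Y \<and>
     (i = 1 \<or> i - 1 \<notin> Y) \<and> (i + r = n \<or> i + r + 1 \<notin> Y)}"

definition dom_blocks :: "nat \<Rightarrow> (nat \<rightharpoonup> nat) \<Rightarrow> nat \<Rightarrow> nat set set" where
  "dom_blocks n \<alpha> k = {A \<in> blocks n (dom \<alpha>). card A = k}"

text \<open>\<open>odd_dom_blocks n \<alpha> k\<close> is \<open>\<alpha>\<^sup>o(2k+1)\<close>: the last argument is \<open>k\<close>, not the size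
  \<open>2k+1\<close> of the blocks.\<close>

definition odd_dom_blocks :: "nat \<Rightarrow> (nat \<rightharpoonup> nat) \<Rightarrow> nat \<Rightarrow> nat set set" where
  "odd_dom_blocks n \<alpha> k =
     {{i..i + 2 * k} |i. {i..i + 2 * k} \<in> dom_blocks n \<alpha> (2 * k + 1) \<and> odd i}"

end

theory Submission
  imports Defs
begin

text \<open>In a semigroup of partial bijections closed under restriction and inversion, two maps are
  \<open>\<J>\<close>-related iff their domains are isomorphic: a factorisation \<open>\<alpha> = s \<beta> t\<close> embeds \<open>dom \<alpha>\<close> into
  \<open>dom \<beta>\<close>, and for finite sets mutual embeddings are isomorphisms. The blocks are the connected
  components of a subset of the fence, so isomorphic subsets have the same numbers of components of
  each isomorphism type. A component is determined up to isomorphism by its size and, for odd size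
  at least three, by the parity of its first element; reflection identifies the two kinds of
  blocks of a given even size.\<close>

section \<open>Isomorphisms between subsets of the fence\<close>

definition fence_iso :: "nat set \<Rightarrow> (nat \<Rightarrow> nat) \<Rightarrow> nat set \<Rightarrow> bool" where
  "fence_iso X f Y \<longleftrightarrow> bij_betw f X Y \<and>
     (\<forall>x \<in> X. \<forall>y \<in> X. fence_less x y \<longleftrightarrow> fence_less (f x) (f y))"

lemma fence_iso_bij: "fence_iso X f Y \<Longrightarrow> bij_betw f X Y"
  by (simp add: fence_iso_def)

lemma fence_iso_less:
  "fence_iso X f Y \<Longrightarrow> x \<in> X \<Longrightarrow> y \<in> X \<Longrightarrow> fence_less (f x) (f y) \<longleftrightarrow> fence_less x y"
  by (simp add: fence_iso_def)

lemma fence_iso_inv_into: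
  assumes "fence_iso X f Y"
  shows "fence_iso Y (inv_into X f) X"
proof -
  have b: "bij_betw f X Y" using assms by (rule fence_iso_bij)
  show ?thesis
    unfolding fence_iso_def
  proof (intro conjI ballI)
    show "bij_betw (inv_into X f) Y X" using b by (rule bij_betw_inv_into)
    fix x y assume "x \<in> Y" "y \<in> Y"
    then show "fence_less x y \<longleftrightarrow> fence_less (inv_into X f x) (inv_into X f y)"
      using fence_iso_less[OF assms, of "inv_into X f x" "inv_into X f y"] b
      by (metis bij_betw_inv_into_right bij_betw_imp_surj_on inv_into_into)
  qed
qed

lemma fence_iso_comp:
  assumes "fence_iso X f Y" "fence_iso Y g Z"
  shows "fence_iso X (g \<circ> f) Z"
  using assms bij_betw_trans[of f X Y g Z]
  unfolding fence_iso_def by (auto simp: bij_betw_apply)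

lemma fence_iso_map:
  assumes "\<alpha> \<in> IF_semigroup n"
  shows "fence_iso (dom \<alpha>) (the \<circ> \<alpha>) (ran \<alpha>)"
proof -
  have "inj_on \<alpha> (dom \<alpha>)"
    and *: "\<forall>x \<in> dom \<alpha>. \<forall>y \<in> dom \<alpha>. fence_less x y \<longleftrightarrow> fence_less (the (\<alpha> x)) (the (\<alpha> y))"
    using assms by (auto simp: IF_semigroup_def sym_inv_def)
  then have "inj_on (the \<circ> \<alpha>) (dom \<alpha>)"
    by (auto simp: inj_on_def dom_def)
  moreover have "(the \<circ> \<alpha>) ` dom \<alpha> = ran \<alpha>"
    by (force simp: ran_def dom_def image_def)
  ultimately show ?thesis using * by (simp add: fence_iso_def bij_betw_def)
qed

lemma IF_semigroup_subset:
  assumes "\<alpha> \<in> IF_semigroup n"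
  shows "dom \<alpha> \<subseteq> fence n" "ran \<alpha> \<subseteq> fence n"
  using assms by (simp_all add: IF_semigroup_def sym_inv_def)

lemma Min_interval [simp]: "i \<le> j \<Longrightarrow> Min {i..j::nat} = i"
  by (rule Min_eqI) auto

definition restricted :: "nat set \<Rightarrow> (nat \<Rightarrow> nat) \<Rightarrow> (nat \<rightharpoonup> nat)" where
  "restricted X f = (\<lambda>x. if x \<in> X then Some (f x) else None)"

lemma dom_restricted [simp]: "dom (restricted X f) = X"
  by (auto simp: restricted_def dom_def)

text \<open>Converse of \<open>fence_iso_map\<close>: the elements of the semigroup are exactly the
  isomorphisms between subsets of the fence, so factors can be built as functions on
  subsets.\<close>

lemma restricted_in_IF_semigroup:
  assumes "fence_iso X f Y" "X \<subseteq> fence n" "Y \<subseteq> fence n"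
  shows "restricted X f \<in> IF_semigroup n"
proof -
  have "ran (restricted X f) = f ` X"
    by (auto simp: restricted_def ran_def)
  moreover have "f ` X = Y" "inj_on f X"
    using fence_iso_bij[OF assms(1)] by (auto simp: bij_betw_def)
  moreover have "inj_on (restricted X f) X"
    using \<open>inj_on f X\<close> by (auto simp: inj_on_def restricted_def)
  moreover have "fence_less x y \<longleftrightarrow>
      fence_less (the (restricted X f x)) (the (restricted X f y))"
    if "x \<in> X" "y \<in> X" for x y
    using fence_iso_less[OF assms(1) that] that by (simp add: restricted_def)
  ultimately show ?thesis
    using assms(2,3) by (simp add: IF_semigroup_def sym_inv_def)
qed

section \<open>Green's relation and isomorphism of domains\<close>

text \<open>All four forms in the ideal of \<open>\<alpha>\<close> collapse to the single form
  \<open>s' \<beta> t'\<close>: the outer factors are absorbed into \<open>s\<close> and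
  \<open>t\<close> by associativity and closure.\<close>

lemma principal_ideal_subset:
  assumes "s \<in> IF_semigroup n" "t \<in> IF_semigroup n" "\<alpha> = pmult (pmult s \<beta>) t"
  shows "principal_ideal (IF_semigroup n) pmult \<alpha> \<subseteq> principal_ideal (IF_semigroup n) pmult \<beta>"
proof
  fix x assume "x \<in> principal_ideal (IF_semigroup n) pmult \<alpha>"
  then consider "x = \<alpha>"
    | s' where "s' \<in> IF_semigroup n" "x = pmult s' \<alpha>"
    | t' where "t' \<in> IF_semigroup n" "x = pmult \<alpha> t'"
    | s' t' where "s' \<in> IF_semigroup n" "t' \<in> IF_semigroup n" "x = pmult (pmult s' \<alpha>) t'"
    unfolding principal_ideal_def by blast
  then have "\<exists>s' t'. s' \<in> IF_semigroup n \<and> t' \<in> IF_semigroup n \<and> x = pmult (pmult s' \<beta>) t'"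
  proof cases
    case 1
    then show ?thesis using assms by blast
  next
    case (2 s')
    then have "x = pmult (pmult (pmult s' s) \<beta>) t" by (simp add: assms(3) pmult_assoc)
    then show ?thesis using assms(1,2) 2(1) pmult_closed by blast
  next
    case (3 t')
    then have "x = pmult (pmult s \<beta>) (pmult t t')" by (simp add: assms(3) pmult_assoc)
    then show ?thesis using assms(1,2) 3(1) pmult_closed by blast
  next
    case (4 s' t')
    then have "x = pmult (pmult (pmult s' s) \<beta>) (pmult t t')"
      by (simp add: assms(3) pmult_assoc)
    then show ?thesis using assms(1,2) 4(1,2) pmult_closed by blast
  qed
  then show "x \<in> principal_ideal (IF_semigroup n) pmult \<beta>"
    unfolding principal_ideal_def by blast
qed

text \<open>The left factor carries \<open>dom \<alpha>\<close> onto \<open>dom \<beta>\<close> by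
  \<open>f\<close>; the right factor undoes first \<open>\<beta>\<close> and then \<open>f\<close>,
  and finally applies \<open>\<alpha>\<close>.\<close>

lemma factor_through_isomorphic_domain:
  assumes \<alpha>: "\<alpha> \<in> IF_semigroup n" and \<beta>: "\<beta> \<in> IF_semigroup n"
    and f: "fence_iso (dom \<alpha>) f (dom \<beta>)"
  shows "\<exists>s \<in> IF_semigroup n. \<exists>t \<in> IF_semigroup n. \<alpha> = pmult (pmult s \<beta>) t"
proof -
  define h where "h = inv_into (dom \<alpha>) f"
  define b where "b = inv_into (dom \<beta>) (the \<circ> \<beta>)"
  define s where "s = restricted (dom \<alpha>) f"
  \<comment> \<open>The route is \<open>ran \<beta>\<close> to \<open>dom \<beta>\<close> by
    \<open>b\<close>, on to \<open>dom \<alpha>\<close> by \<open>h\<close>, and on to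
    \<open>ran \<alpha>\<close> by \<open>\<alpha>\<close>.\<close>
  define t where "t = restricted (ran \<beta>) ((the \<circ> \<alpha>) \<circ> (h \<circ> b))"
  have bij\<beta>: "bij_betw (the \<circ> \<beta>) (dom \<beta>) (ran \<beta>)"
    using fence_iso_map[OF \<beta>] by (rule fence_iso_bij)
  have "fence_iso (ran \<beta>) b (dom \<beta>)" "fence_iso (dom \<beta>) h (dom \<alpha>)"
    unfolding h_def b_def using fence_iso_map[OF \<beta>] f by (simp_all add: fence_iso_inv_into)
  then have "fence_iso (ran \<beta>) ((the \<circ> \<alpha>) \<circ> (h \<circ> b)) (ran \<alpha>)"
    using fence_iso_map[OF \<alpha>] fence_iso_comp by blast
  then have t: "t \<in> IF_semigroup n"
    unfolding t_def using IF_semigroup_subset \<alpha> \<beta> by (intro restricted_in_IF_semigroup)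
  have s: "s \<in> IF_semigroup n"
    unfolding s_def using IF_semigroup_subset \<alpha> \<beta> f by (intro restricted_in_IF_semigroup)
  have "\<alpha> x = pmult (pmult s \<beta>) t x" for x
  proof (cases "x \<in> dom \<alpha>")
    case True
    then have fx: "f x \<in> dom \<beta>" using fence_iso_bij[OF f] by (rule bij_betw_apply[rotated])
    then obtain z where z: "\<beta> (f x) = Some z" by auto
    have "b z = f x"
      using bij_betw_inv_into_left[OF bij\<beta> fx] z by (simp add: b_def)
    moreover have "h (f x) = x"
      unfolding h_def using fence_iso_bij[OF f] True by (rule bij_betw_inv_into_left)
    moreover have "z \<in> ran \<beta>" using z by (rule ranI)
    ultimately show ?thesis
      using True z by (auto simp: pmult_def s_def t_def restricted_def)
  next
    case False
    then show ?thesis by (auto simp: pmult_def s_def restricted_def map_comp_def)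
  qed
  then show ?thesis using s t by blast
qed

text \<open>A right factor only shrinks the domain, so the embedding is the identity if there is no
  left factor, and the left factor \<open>s\<close> otherwise.\<close>

lemma principal_ideal_embedding:
  assumes "\<beta> \<in> IF_semigroup n" "\<alpha> \<in> principal_ideal (IF_semigroup n) pmult \<beta>"
  shows "\<exists>f. inj_on f (dom \<alpha>) \<and> f ` dom \<alpha> \<subseteq> dom \<beta> \<and>
    (\<forall>x \<in> dom \<alpha>. \<forall>y \<in> dom \<alpha>. fence_less x y \<longleftrightarrow> fence_less (f x) (f y))"
proof -
  have left: "dom (pmult s \<beta>) \<subseteq> dom s \<and> (the \<circ> s) ` dom (pmult s \<beta>) \<subseteq> dom \<beta>"
    for s by (auto simp: pmult_def map_comp_def split: option.splits)
  have right: "dom (pmult \<sigma> t) \<subseteq> dom \<sigma>" for \<sigma> t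
    by (auto simp: pmult_def map_comp_def split: option.splits)
  consider "dom \<alpha> \<subseteq> dom \<beta>"
    | s where "s \<in> IF_semigroup n" "dom \<alpha> \<subseteq> dom (pmult s \<beta>)"
    using assms(2) right unfolding principal_ideal_def by blast
  then show ?thesis
  proof cases
    case 1
    then show ?thesis by (intro exI[of _ id]) auto
  next
    case 2
    have s: "fence_iso (dom s) (the \<circ> s) (ran s)" using 2(1) by (rule fence_iso_map)
    have sub: "dom \<alpha> \<subseteq> dom s" "(the \<circ> s) ` dom \<alpha> \<subseteq> dom \<beta>"
      using left[of s] 2(2) image_mono[OF 2(2), of "the \<circ> s"] by (meson subset_trans)+
    have "inj_on (the \<circ> s) (dom \<alpha>)"
      using bij_betw_imp_inj_on[OF fence_iso_bij[OF s]] sub(1) by (rule inj_on_subset)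
    moreover have "fence_less x y \<longleftrightarrow> fence_less ((the \<circ> s) x) ((the \<circ> s) y)"
      if "x \<in> dom \<alpha>" "y \<in> dom \<alpha>" for x y
      using fence_iso_less[OF s, of x y] that sub(1) by (simp only: subset_iff)
    ultimately show ?thesis using sub(2) by (intro exI[of _ "the \<circ> s"]) simp
  qed
qed

lemma green_J_iff_fence_iso:
  assumes \<alpha>: "\<alpha> \<in> IF_semigroup n" and \<beta>: "\<beta> \<in> IF_semigroup n"
  shows "green_J (IF_semigroup n) pmult \<alpha> \<beta> \<longleftrightarrow> (\<exists>f. fence_iso (dom \<alpha>) f (dom \<beta>))"
proof
  assume "green_J (IF_semigroup n) pmult \<alpha> \<beta>"
  then have "\<alpha> \<in> principal_ideal (IF_semigroup n) pmult \<beta>"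
    "\<beta> \<in> principal_ideal (IF_semigroup n) pmult \<alpha>"
    by (auto simp: green_J_def principal_ideal_def)
  then obtain f g where
    f: "inj_on f (dom \<alpha>)" "f ` dom \<alpha> \<subseteq> dom \<beta>"
       "\<forall>x \<in> dom \<alpha>. \<forall>y \<in> dom \<alpha>. fence_less x y \<longleftrightarrow> fence_less (f x) (f y)"
    and g: "inj_on g (dom \<beta>)" "g ` dom \<beta> \<subseteq> dom \<alpha>"
    using principal_ideal_embedding \<alpha> \<beta> by metis
  have fin: "finite (dom \<alpha>)" "finite (dom \<beta>)"
    using IF_semigroup_subset(1)[OF \<alpha>] IF_semigroup_subset(1)[OF \<beta>]
    by (auto simp: fence_def intro: finite_subset)
  \<comment> \<open>The second embedding \<open>g\<close> serves only to compare cardinalities; by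
    finiteness \<open>f\<close> is then onto.\<close>
  then have "card (dom \<beta>) \<le> card (f ` dom \<alpha>)"
    using card_inj_on_le[OF g] card_image[OF f(1)] by simp
  then have "f ` dom \<alpha> = dom \<beta>"
    using f(2) fin(2) by (intro card_seteq)
  then show "\<exists>f. fence_iso (dom \<alpha>) f (dom \<beta>)"
    using f by (auto simp: fence_iso_def bij_betw_def)
next
  assume "\<exists>f. fence_iso (dom \<alpha>) f (dom \<beta>)"
  then obtain f where f: "fence_iso (dom \<alpha>) f (dom \<beta>)" ..
  have "principal_ideal (IF_semigroup n) pmult \<alpha> \<subseteq> principal_ideal (IF_semigroup n) pmult \<beta>"
    using factor_through_isomorphic_domain[OF \<alpha> \<beta> f] principal_ideal_subset by blast
  moreover have
    "principal_ideal (IF_semigroup n) pmult \<beta> \<subseteq> principal_ideal (IF_semigroup n) pmult \<alpha>"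
    using factor_through_isomorphic_domain[OF \<beta> \<alpha> fence_iso_inv_into[OF f]]
      principal_ideal_subset by blast
  ultimately show "green_J (IF_semigroup n) pmult \<alpha> \<beta>"
    using \<alpha> \<beta> by (simp add: green_J_def)
qed

section \<open>Blocks as connected components\<close>

text \<open>Comparability is adjacency of indices, which is what makes blocks the connected
  components.\<close>

lemma fence_less_adjacent:
  "fence_less x y \<or> fence_less y x \<longleftrightarrow> y = Suc x \<or> x = Suc y"
  by (auto simp: fence_less_def)

text \<open>The boundary cases disappear because \<open>0\<close> and \<open>Suc n\<close> lie
  outside \<open>X\<close>. Truncated subtraction does no harm: \<open>i = 0\<close> would force
  \<open>0\<close> into \<open>X\<close>.\<close>

lemma blocks_eq:
  assumes "X \<subseteq> fence n"
  shows "blocks n X = {{i..j} |i j. i \<le> j \<and> {i..j} \<subseteq> X \<and> i - 1 \<notin> X \<and> Suc j \<notin> X}"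
    (is "_ = ?R")
proof (intro subset_antisym subsetI)
  fix A assume "A \<in> blocks n X"
  then obtain i r where "A = {i..i + r}" "{i..i + r} \<subseteq> X" "i = 1 \<or> i - 1 \<notin> X"
    "i + r = n \<or> i + r + 1 \<notin> X"
    unfolding blocks_def by blast
  moreover have "0 \<notin> X" "Suc n \<notin> X" using assms by (auto simp: fence_def)
  ultimately show "A \<in> ?R" by (intro CollectI exI[of _ i] exI[of _ "i + r"]) auto
next
  fix A assume "A \<in> ?R"
  then obtain i j where ij: "A = {i..j}" "i \<le> j" "{i..j} \<subseteq> X" "i - 1 \<notin> X" "Suc j \<notin> X"
    by blast
  then have "i \<in> X" "j \<in> X" by auto
  then have "1 \<le> i" "j \<le> n" using assms by (auto simp: fence_def)
  then show "A \<in> blocks n X"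
    using ij unfolding blocks_def by (intro CollectI exI[of _ i] exI[of _ "j - i"]) auto
qed

lemma blockE:
  assumes "X \<subseteq> fence n" "A \<in> blocks n X"
  obtains i j where "A = {i..j}" "1 \<le> i" "i \<le> j" "{i..j} \<subseteq> X" "i - 1 \<notin> X" "Suc j \<notin> X"
proof -
  obtain i j where ij: "A = {i..j}" "i \<le> j" "{i..j} \<subseteq> X" "i - 1 \<notin> X" "Suc j \<notin> X"
    using assms(2) unfolding blocks_eq[OF assms(1)] by blast
  then have "1 \<le> i" by (cases i) auto
  with ij that show ?thesis by blast
qed

lemma block_subset: "A \<in> blocks n X \<Longrightarrow> A \<subseteq> X"
  unfolding blocks_def by blast

lemma finite_blocks: "X \<subseteq> fence n \<Longrightarrow> finite (blocks n X)"
  by (rule finite_subset[of _ "Pow X"])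
    (auto simp: block_subset fence_def intro: finite_subset dest: block_subset)

text \<open>The indices just outside one block are not in \<open>X\<close>, hence not in the other
  block; two intersecting intervals with this property have the same endpoints.\<close>

lemma block_disjoint:
  assumes X: "X \<subseteq> fence n" and A: "A \<in> blocks n X" and B: "B \<in> blocks n X"
    and x: "x \<in> A" "x \<in> B"
  shows "A = B"
proof -
  obtain i j where A: "A = {i..j}" "1 \<le> i" "i \<le> j" "{i..j} \<subseteq> X" "i - 1 \<notin> X" "Suc j \<notin> X"
    using X A by (rule blockE)
  obtain k l where B: "B = {k..l}" "1 \<le> k" "k \<le> l" "{k..l} \<subseteq> X" "k - 1 \<notin> X" "Suc l \<notin> X"
    using X B by (rule blockE)
  have "k - 1 \<notin> {i..j}" "Suc l \<notin> {i..j}" "i - 1 \<notin> {k..l}" "Suc j \<notin> {k..l}"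
    using A B by blast+
  then have "i = k" "j = l" using A(1,2) B(1,2) x by auto
  then show ?thesis using A B by simp
qed

lemma block_exists:
  assumes X: "X \<subseteq> fence n" and x: "x \<in> X"
  shows "\<exists>A \<in> blocks n X. x \<in> A"
proof -
  have fin: "finite X" using X by (auto simp: fence_def intro: finite_subset)
  \<comment> \<open>The block is obtained by extending \<open>{x}\<close> inside \<open>X\<close> as
    far as possible, down to \<open>i\<close> and up to \<open>j\<close>.\<close>
  define i where "i = (LEAST i. {i..x} \<subseteq> X \<and> i \<le> x)"
  define J where "J = {j. x \<le> j \<and> {x..j} \<subseteq> X}"
  define j where "j = Max J"
  have i: "{i..x} \<subseteq> X \<and> i \<le> x"
    unfolding i_def by (rule LeastI[of _ x]) (use x in auto)
  have "J \<subseteq> X" by (auto simp: J_def)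
  then have J: "finite J" "x \<in> J" using fin x by (auto simp: J_def intro: finite_subset)
  then have j: "x \<le> j" "{x..j} \<subseteq> X"
    using Max_in[of J] unfolding j_def by (auto simp only: J_def)
  have "i \<in> X" using i by auto
  then have i1: "1 \<le> i" using X by (auto simp: fence_def)
  have "i - 1 \<notin> X"
  proof
    assume "i - 1 \<in> X"
    moreover have "{i - 1..x} = insert (i - 1) {i..x}" using i i1 by auto
    ultimately have "{i - 1..x} \<subseteq> X \<and> i - 1 \<le> x" using i by auto
    then have "i \<le> i - 1" unfolding i_def by (rule Least_le)
    then show False using i1 by simp
  qed
  moreover have "Suc j \<notin> X"
  proof
    assume "Suc j \<in> X"
    then have "Suc j \<in> J" using j by (auto simp: J_def atLeastAtMostSuc_conv)
    then show False using Max_ge[OF J(1)] by (force simp: j_def)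
  qed
  moreover have "{i..j} \<subseteq> X"
  proof
    fix z assume "z \<in> {i..j}"
    then show "z \<in> X" using i j by (cases "z \<le> x") auto
  qed
  ultimately have "{i..j} \<in> blocks n X"
    unfolding blocks_eq[OF X] using i j by (intro CollectI exI[of _ i] exI[of _ j]) auto
  then show ?thesis using i j by (intro bexI[of _ "{i..j}"]) auto
qed

text \<open>A step by one could leave the block only at \<open>i - 1\<close> or
  \<open>Suc j\<close>, and both are outside \<open>X\<close>.\<close>

lemma block_closed_adjacent:
  assumes X: "X \<subseteq> fence n" and A: "A \<in> blocks n X" "x \<in> A"
    and y: "y \<in> X" "y = Suc x \<or> x = Suc y"
  shows "y \<in> A"
proof -
  obtain i j where A': "A = {i..j}" "1 \<le> i" "i \<le> j" "{i..j} \<subseteq> X" "i - 1 \<notin> X" "Suc j \<notin> X"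
    using X A(1) by (rule blockE)
  then have "y \<noteq> i - 1" "y \<noteq> Suc j" using y(1) by auto
  then show ?thesis using A' A(2) y(2) by auto
qed

section \<open>Isomorphisms preserve the numbers of blocks\<close>

text \<open>A discrete intermediate value argument: each new value differs by one from a value
  already in the image, so it lies in the interval found so far or extends it by one at an
  end.\<close>

lemma image_interval:
  fixes f :: "nat \<Rightarrow> nat"
  assumes "i \<le> j" "\<And>x. i \<le> x \<Longrightarrow> x < j \<Longrightarrow> f (Suc x) = Suc (f x) \<or> f x = Suc (f (Suc x))"
  shows "\<exists>c d. c \<le> d \<and> f ` {i..j} = {c..d}"
  using assms
proof (induction j rule: dec_induct)
  case base
  then show ?case by (intro exI[of _ "f i"]) auto
next
  case (step m)
  then obtain c d where cd: "c \<le> d" "f ` {i..m} = {c..d}" by force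
  have *: "{i..Suc m} = insert (Suc m) {i..m}" using step.hyps by auto
  have "f m \<in> {c..d}" using cd(2) step.hyps by fastforce
  moreover have "f (Suc m) = Suc (f m) \<or> f m = Suc (f (Suc m))" using step by simp
  ultimately consider "f (Suc m) \<in> {c..d}" | "f (Suc m) = Suc d" | "Suc (f (Suc m)) = c"
    by fastforce
  then show ?case
  proof cases
    case 1
    then show ?thesis using cd by (intro exI[of _ c] exI[of _ d]) (auto simp: *)
  next
    case 2
    then show ?thesis using cd by (intro exI[of _ c] exI[of _ "Suc d"]) (auto simp: *)
  next
    case 3
    then show ?thesis using cd by (intro exI[of _ "f (Suc m)"] exI[of _ d]) (auto simp: *)
  qed
qed

lemma fence_iso_adjacent:
  assumes "fence_iso X f Y" "x \<in> X" "y \<in> X"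
  shows "f y = Suc (f x) \<or> f x = Suc (f y) \<longleftrightarrow> y = Suc x \<or> x = Suc y"
  using fence_iso_less[OF assms] fence_iso_less[OF assms(1,3,2)]
  unfolding fence_less_adjacent[symmetric] by blast

text \<open>Adjacency is preserved, so the image is an interval. It is maximal, since an element of
  \<open>Y\<close> adjacent to it pulls back to an element of \<open>X\<close> adjacent to
  \<open>A\<close>, which lies in \<open>A\<close>.\<close>

lemma fence_iso_image_block:
  assumes f: "fence_iso X f Y" and X: "X \<subseteq> fence n" and Y: "Y \<subseteq> fence n"
    and A: "A \<in> blocks n X"
  shows "f ` A \<in> blocks n Y"
proof -
  obtain i j where ij: "A = {i..j}" "1 \<le> i" "i \<le> j" "{i..j} \<subseteq> X" "i - 1 \<notin> X" "Suc j \<notin> X"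
    using X A by (rule blockE)
  have "f (Suc x) = Suc (f x) \<or> f x = Suc (f (Suc x))" if "i \<le> x" "x < j" for x
    using fence_iso_adjacent[OF f, of x "Suc x"] that ij(4) by (auto simp: subset_iff)
  then obtain c d where cd: "c \<le> d" "f ` A = {c..d}"
    using image_interval[of i j f] ij by blast
  have surj: "f ` X = Y" using fence_iso_bij[OF f] by (auto simp: bij_betw_def)
  have "{c..d} \<subseteq> Y" using cd(2) surj ij(1,4) by blast
  have closed: "v \<in> f ` A" if "u \<in> f ` A" "v \<in> Y" "v = Suc u \<or> u = Suc v" for u v
  proof -
    from that(1) obtain x where x: "x \<in> A" "u = f x" by blast
    from that(2) surj obtain y where y: "y \<in> X" "v = f y" by blast
    have "x \<in> X" using x(1) ij(1,4) by auto
    then have "y = Suc x \<or> x = Suc y"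
      using fence_iso_adjacent[OF f \<open>x \<in> X\<close> y(1)] x(2) y(2) that(3) by simp
    then have "y \<in> A" by (rule block_closed_adjacent[OF X A x(1) y(1)])
    then show ?thesis using y(2) by blast
  qed
  \<comment> \<open>This makes \<open>c - 1\<close> a genuine predecessor of \<open>c\<close>,
    different from \<open>c\<close> itself.\<close>
  have "1 \<le> c" using \<open>{c..d} \<subseteq> Y\<close> cd(1) Y by (auto simp: fence_def subset_iff)
  then have "c - 1 \<notin> Y" using closed[of c "c - 1"] cd by auto
  moreover have "Suc d \<notin> Y" using closed[of d "Suc d"] cd by auto
  ultimately show ?thesis
    unfolding blocks_eq[OF Y] cd(2) using cd(1) \<open>{c..d} \<subseteq> Y\<close> by blast
qed

text \<open>An element with a neighbour is odd iff it is the smaller of the two, which the order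
  detects. An isolated point has no such constraint.\<close>

lemma fence_iso_odd:
  assumes f: "fence_iso X f Y" and "x \<in> X" "y \<in> X" "y = Suc x \<or> x = Suc y"
  shows "odd (f x) \<longleftrightarrow> odd x"
  using fence_iso_less[OF assms(1-3)] fence_iso_less[OF assms(1,3,2)] assms(4)
  unfolding fence_less_def by (metis Suc_eq_plus1 even_Suc)

text \<open>In a block of odd size that starts at an odd index every even element has two neighbours,
  so no even element can be mapped to the first element of the image.\<close>

lemma fence_iso_odd_Min:
  assumes f: "fence_iso X f Y" and X: "X \<subseteq> fence n" and Y: "Y \<subseteq> fence n"
    and A: "A \<in> blocks n X" "card A = 2 * k + 1" "1 \<le> k" "odd (Min A)"
  shows "odd (Min (f ` A))"
proof
  assume even: "even (Min (f ` A))"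
  obtain i j where ij: "A = {i..j}" "1 \<le> i" "i \<le> j" "{i..j} \<subseteq> X"
    using X A(1) by (rule blockE)
  have "odd i" using A(4) ij by simp
  have j: "j = i + 2 * k" using A(2) ij by simp
  have inj: "inj_on f X" using fence_iso_bij[OF f] by (auto simp: bij_betw_def)
  have "Min (f ` A) \<in> f ` A" using ij by (intro Min_in) auto
  then obtain x where x: "x \<in> A" "Min (f ` A) = f x" by blast
  have xX: "x \<in> X" using x(1) ij by blast
  \<comment> \<open>A block with at least three elements gives \<open>x\<close> a neighbour, so
    \<open>x\<close> has the parity of \<open>f x\<close>.\<close>
  obtain y where "y \<in> A" "y = Suc x \<or> x = Suc y"
  proof (cases "x = j")
    case True
    then show ?thesis using that[of "x - 1"] ij(1,2) j A(3) by auto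
  next
    case False
    then show ?thesis using that[of "Suc x"] ij(1) x(1) by auto
  qed
  then have "even x"
    using fence_iso_odd[OF f xX, of y] even x(2) ij by auto
  then have "x \<noteq> i" "x \<noteq> j" using \<open>odd i\<close> j by auto
  then have nb: "x - 1 \<in> A" "Suc x \<in> A" "x = Suc (x - 1)"
    using x(1) ij(1,2) by auto
  then have nbX: "x - 1 \<in> X" "Suc x \<in> X" using ij(1,4) by blast+
  have ge: "f x \<le> f z" if "z \<in> A" for z
    unfolding x(2)[symmetric] using that ij(1) by (intro Min_le) auto
  \<comment> \<open>The images of both neighbours are adjacent to the minimum \<open>f x\<close> and
    not below it, so they coincide, against injectivity.\<close>
  have "f (x - 1) = Suc (f x)"
    using fence_iso_adjacent[OF f xX nbX(1)] nb(3) ge[OF nb(1)] by linarith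
  moreover have "f (Suc x) = Suc (f x)"
    using fence_iso_adjacent[OF f xX nbX(2)] ge[OF nb(2)] by linarith
  ultimately have "x - 1 = Suc x" using inj_onD[OF inj _ nbX] by simp
  then show False by simp
qed

text \<open>Stated through \<open>Min A\<close> and for a bare set, so that it can be tracked under
  images.\<close>

definition odd_blocks :: "nat \<Rightarrow> nat set \<Rightarrow> nat \<Rightarrow> nat set set" where
  "odd_blocks n X k = {A \<in> blocks n X. card A = 2 * k + 1 \<and> odd (Min A)}"

lemma odd_dom_blocks_eq:
  assumes "dom \<alpha> \<subseteq> fence n"
  shows "odd_dom_blocks n \<alpha> k = odd_blocks n (dom \<alpha>) k"
proof (intro subset_antisym subsetI)
  fix A assume "A \<in> odd_dom_blocks n \<alpha> k"
  then show "A \<in> odd_blocks n (dom \<alpha>) k"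
    by (auto simp: odd_dom_blocks_def dom_blocks_def odd_blocks_def)
next
  fix A assume A: "A \<in> odd_blocks n (dom \<alpha>) k"
  then have "A \<in> blocks n (dom \<alpha>)" by (simp add: odd_blocks_def)
  with assms obtain i j where ij: "A = {i..j}" "i \<le> j" by (rule blockE)
  then have "j = i + 2 * k" "odd i" using A by (auto simp: odd_blocks_def)
  then show "A \<in> odd_dom_blocks n \<alpha> k"
    using A ij by (auto simp: odd_dom_blocks_def dom_blocks_def odd_blocks_def)
qed

text \<open>Taking images is injective on blocks and preserves size and kind. Inequalities suffice,
  since the inverse isomorphism gives the reverse ones. The bound on \<open>k\<close> excludes
  singletons, whose parity can change.\<close>

lemma fence_iso_card_le:
  assumes f: "fence_iso X f Y" and X: "X \<subseteq> fence n" and Y: "Y \<subseteq> fence n"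
  shows "card {A \<in> blocks n X. card A = k} \<le> card {A \<in> blocks n Y. card A = k}"
    and "1 \<le> k \<Longrightarrow> card (odd_blocks n X k) \<le> card (odd_blocks n Y k)"
proof -
  have inj: "inj_on f X" using fence_iso_bij[OF f] by (simp add: bij_betw_def)
  have inj_image: "inj_on ((`) f) (blocks n X)"
    using inj_on_image_Pow[OF inj] by (rule inj_on_subset) (auto dest: block_subset)
  have card: "card (f ` A) = card A" if "A \<in> blocks n X" for A
    using inj_on_subset[OF inj block_subset[OF that]] by (rule card_image)
  show "card {A \<in> blocks n X. card A = k} \<le> card {A \<in> blocks n Y. card A = k}"
  proof (rule card_inj_on_le[where f = "(`) f"])
    show "inj_on ((`) f) {A \<in> blocks n X. card A = k}"
      using inj_image by (rule inj_on_subset) simp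
  qed (use finite_blocks[OF Y] fence_iso_image_block[OF f X Y] card in auto)
  show "card (odd_blocks n X k) \<le> card (odd_blocks n Y k)" if "1 \<le> k"
  proof (rule card_inj_on_le[where f = "(`) f"])
    show "inj_on ((`) f) (odd_blocks n X k)"
      using inj_image by (rule inj_on_subset) (simp add: odd_blocks_def)
    show "(`) f ` odd_blocks n X k \<subseteq> odd_blocks n Y k"
    proof (rule image_subsetI)
      fix A assume "A \<in> odd_blocks n X k"
      then have A: "A \<in> blocks n X" "card A = 2 * k + 1" "odd (Min A)"
        by (simp_all add: odd_blocks_def)
      then show "f ` A \<in> odd_blocks n Y k"
        using fence_iso_image_block[OF f X Y A(1)] card[OF A(1)]
          fence_iso_odd_Min[OF f X Y A(1,2) that A(3)]
        by (simp add: odd_blocks_def)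
    qed
    show "finite (odd_blocks n Y k)"
      using finite_blocks[OF Y] by (simp add: odd_blocks_def)
  qed
qed

section \<open>Equal numbers of blocks give an isomorphism\<close>

text \<open>A complete isomorphism invariant of blocks. The flag is forced to \<open>False\<close>
  for even sizes and singletons, where the parity of the first index is not invariant.\<close>

definition block_type :: "nat set \<Rightarrow> nat \<times> bool" where
  "block_type A = (card A, odd (card A) \<and> card A \<noteq> 1 \<and> odd (Min A))"

lemma fence_iso_intervals:
  assumes type: "block_type {i..j} = block_type {k..l}" and "i \<le> j" "k \<le> l"
  shows "\<exists>g. fence_iso {i..j} g {k..l}"
proof -
  have len: "j + k = l + i" using assms by (auto simp: block_type_def)
  have "even i = even k" if "even (j - i)" "i \<noteq> j"
  proof -
    have "card {i..j} = Suc (j - i)" "card {k..l} = Suc (j - i)"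
      using len assms(2,3) by auto
    then have "odd i = odd k"
      using type assms(2,3) that by (simp add: block_type_def)
    then show ?thesis by blast
  qed
  \<comment> \<open>With an even number of elements the endpoints \<open>k\<close> and
    \<open>l\<close> have different parities, so \<open>i\<close> agrees with one of them: with
    \<open>k\<close> a translation works, with \<open>l\<close> a reflection.\<close>
  moreover have "even i = even k \<or> even (i + l)" if "odd (j - i)"
    using that len assms(2,3) by presburger
  ultimately consider (translate) "even i = even k" | (reflect) "even (i + l)" | (point) "i = j"
    by blast
  then show ?thesis
  proof cases
    case translate
    \<comment> \<open>Adding before subtracting avoids truncation, because \<open>i \<le> x\<close>;
      the shift is even and keeps the order.\<close>
    have "bij_betw (\<lambda>x. x + k - i) {i..j} {k..l}"
      by (rule bij_betw_byWitness[where f' = "\<lambda>x. x + i - k"]) (use len in auto)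
    moreover have "fence_less x y \<longleftrightarrow> fence_less (x + k - i) (y + k - i)"
      if "x \<in> {i..j}" "y \<in> {i..j}" for x y
    proof -
      have "odd (x + k - i) = odd x" using that translate by auto
      then show ?thesis using that by (auto simp: fence_less_def)
    qed
    ultimately show ?thesis unfolding fence_iso_def by blast
  next
    case reflect
    have "bij_betw (\<lambda>x. l + i - x) {i..j} {k..l}"
      by (rule bij_betw_byWitness[where f' = "\<lambda>x. l + i - x"]) (use len in auto)
    moreover have "fence_less x y \<longleftrightarrow> fence_less (l + i - x) (l + i - y)"
      if "x \<in> {i..j}" "y \<in> {i..j}" for x y
    proof -
      have "x \<le> l + i" "y \<le> l + i" using that len by auto
      moreover from this have "odd (l + i - x) = odd x" using reflect by auto
      ultimately show ?thesis by (auto simp: fence_less_def)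
    qed
    ultimately show ?thesis unfolding fence_iso_def by blast
  next
    case point
    then have "fence_iso {i..j} (\<lambda>_. k) {k..l}"
      using len by (auto simp: fence_iso_def bij_betw_def fence_less_def)
    then show ?thesis by blast
  qed
qed

text \<open>Choose a bijection between the fibres of \<open>t\<close> over each value and glue;
  distinct fibres are disjoint.\<close>

lemma bij_betw_same_type:
  assumes "finite A" "finite B"
    and "\<And>v. card {a \<in> A. t a = v} = card {b \<in> B. t b = v}"
  shows "\<exists>h. bij_betw h A B \<and> (\<forall>a \<in> A. t (h a) = t a)"
proof -
  have "\<exists>h. bij_betw h {a \<in> A. t a = v} {b \<in> B. t b = v}" for v
    using assms by (intro finite_same_card_bij) auto
  then obtain h where h: "\<And>v. bij_betw (h v) {a \<in> A. t a = v} {b \<in> B. t b = v}" by metis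
  have type: "h (t a) a \<in> B \<and> t (h (t a) a) = t a" if "a \<in> A" for a
    using bij_betw_apply[OF h[of "t a"], of a] that by simp
  have "bij_betw (\<lambda>a. h (t a) a) A B"
  proof (rule bij_betw_imageI)
    show "inj_on (\<lambda>a. h (t a) a) A"
    proof (rule inj_onI)
      fix a b assume ab: "a \<in> A" "b \<in> A" "h (t a) a = h (t b) b"
      then have "t a = t b" using type by metis
      then show "a = b" using ab bij_betw_imp_inj_on[OF h[of "t a"]] by (auto dest: inj_onD)
    qed
    show "(\<lambda>a. h (t a) a) ` A = B"
    proof (intro subset_antisym subsetI)
      fix b assume "b \<in> B"
      then have "b \<in> h (t b) ` {a \<in> A. t a = t b}"
        using bij_betw_imp_surj_on[OF h[of "t b"]] by simp
      then obtain a where "a \<in> A" "t a = t b" "b = h (t b) a" by blast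
      then show "b \<in> (\<lambda>a. h (t a) a) ` A" by (intro image_eqI[of _ _ a]) auto
    qed (use type in auto)
  qed
  then show ?thesis using type by blast
qed

text \<open>The isomorphisms of blocks are glued. Elements of different blocks are incomparable both
  in \<open>X\<close> and after mapping to \<open>Y\<close>, so only pairs within one block matter
  for the order.\<close>

lemma fence_iso_of_block_bijection:
  assumes X: "X \<subseteq> fence n" and Y: "Y \<subseteq> fence n"
    and h: "bij_betw h (blocks n X) (blocks n Y)"
    and iso: "\<And>A. A \<in> blocks n X \<Longrightarrow> \<exists>g. fence_iso A g (h A)"
  shows "\<exists>f. fence_iso X f Y"
proof -
  obtain g where g: "\<And>A. A \<in> blocks n X \<Longrightarrow> fence_iso A (g A) (h A)" using iso by metis
  obtain C where C: "\<And>x. x \<in> X \<Longrightarrow> C x \<in> blocks n X \<and> x \<in> C x"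
    using block_exists[OF X] by metis
  define f where "f x = g (C x) x" for x
  have hC: "h (C x) \<in> blocks n Y" if "x \<in> X" for x
    using bij_betw_apply[OF h] C[OF that] by blast
  have fC: "f x \<in> h (C x)" if "x \<in> X" for x
    unfolding f_def using bij_betw_apply[OF fence_iso_bij[OF g]] C[OF that] by blast
  \<comment> \<open>Images of different blocks lie in different, hence disjoint, blocks of
    \<open>Y\<close>; injectivity and the treatment of incomparable pairs both rest on this.\<close>
  have same: "C x = C y" if "x \<in> X" "y \<in> X" "f y \<in> h (C x)" for x y
  proof -
    have "h (C x) = h (C y)"
      using block_disjoint[OF Y hC[OF that(1)] hC[OF that(2)]] that(3) fC[OF that(2)] by blast
    then show ?thesis
      using bij_betw_imp_inj_on[OF h] C that(1,2) by (blast dest: inj_onD)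
  qed
  have C_eq: "C x = A" if "A \<in> blocks n X" "x \<in> A" for A x
    using block_disjoint[OF X _ that(1) _ that(2)] C block_subset that by blast
  have "inj_on f X"
  proof (rule inj_onI)
    fix x y assume xy: "x \<in> X" "y \<in> X" "f x = f y"
    then have "C x = C y" using same[of x y] fC[of x] by simp
    then show "x = y"
      using xy C bij_betw_imp_inj_on[OF fence_iso_bij[OF g]] unfolding f_def
      by (metis inj_onD)
  qed
  moreover have "f ` X = Y"
  proof (intro subset_antisym subsetI)
    fix y assume "y \<in> f ` X"
    then show "y \<in> Y" using fC hC block_subset by blast
  next
    fix y assume "y \<in> Y"
    then obtain B where B: "B \<in> blocks n Y" "y \<in> B" using block_exists[OF Y] by blast
    then obtain A where A: "A \<in> blocks n X" "h A = B"
      using bij_betw_imp_surj_on[OF h] by (metis imageE)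
    have "g A ` A = B" using bij_betw_imp_surj_on[OF fence_iso_bij[OF g[OF A(1)]]] A(2) by simp
    then obtain x where x: "x \<in> A" "y = g A x" using B(2) by blast
    then have "y = f x" "x \<in> X"
      using C_eq[OF A(1) x(1)] block_subset[OF A(1)] by (auto simp: f_def)
    then show "y \<in> f ` X" by blast
  qed
  moreover have "fence_less x y \<longleftrightarrow> fence_less (f x) (f y)" if xy: "x \<in> X" "y \<in> X" for x y
  proof (cases "C x = C y")
    case True
    then show ?thesis
      using fence_iso_less[OF g, of "C x" x y] C[OF xy(1)] C[OF xy(2)] by (simp add: f_def)
  next
    case False
    have "\<not> fence_less x y"
    proof
      assume "fence_less x y"
      then have "y = Suc x \<or> x = Suc y" using fence_less_adjacent by blast
      then have "y \<in> C x"
        using C[OF xy(1)] by (intro block_closed_adjacent[OF X _ _ xy(2)]) auto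
      then show False using C_eq C[OF xy(1)] False by metis
    qed
    moreover have "\<not> fence_less (f x) (f y)"
    proof
      assume "fence_less (f x) (f y)"
      then have "f y = Suc (f x) \<or> f x = Suc (f y)" using fence_less_adjacent by blast
      moreover have "f y \<in> Y" using fC[OF xy(2)] hC[OF xy(2)] block_subset by blast
      ultimately have "f y \<in> h (C x)"
        by (intro block_closed_adjacent[OF Y hC[OF xy(1)] fC[OF xy(1)]])
      then show False using same xy False by blast
    qed
    ultimately show ?thesis by simp
  qed
  ultimately have "fence_iso X f Y" by (simp add: fence_iso_def bij_betw_def)
  then show ?thesis by blast
qed

text \<open>Counts by type are determined by the two given families of counts: for odd sizes above
  one, the blocks that start at an even index are the complement of
  \<open>odd_blocks\<close>.\<close>

lemma card_block_type:
  assumes X: "X \<subseteq> fence n"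
  shows "card {A \<in> blocks n X. block_type A = (c, p)} =
    (let T = card {A \<in> blocks n X. card A = c}; D = card (odd_blocks n X (c div 2))
     in if odd c \<and> c \<noteq> 1 then if p then D else T - D else if p then 0 else T)"
proof (cases "odd c \<and> c \<noteq> 1")
  case True
  then have D: "odd_blocks n X (c div 2) = {A \<in> blocks n X. card A = c \<and> odd (Min A)}"
    unfolding odd_blocks_def by (auto elim: oddE)
  show ?thesis
  proof (cases p)
    case True
    then have "{A \<in> blocks n X. block_type A = (c, p)} = odd_blocks n X (c div 2)"
      using \<open>odd c \<and> c \<noteq> 1\<close> D by (auto simp: block_type_def)
    then show ?thesis using \<open>odd c \<and> c \<noteq> 1\<close> True by simp
  next
    case False
    then have "{A \<in> blocks n X. block_type A = (c, p)} =
      {A \<in> blocks n X. card A = c} - odd_blocks n X (c div 2)"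
      using \<open>odd c \<and> c \<noteq> 1\<close> D by (auto simp: block_type_def)
    moreover have "odd_blocks n X (c div 2) \<subseteq> {A \<in> blocks n X. card A = c}"
      using D by auto
    moreover have "finite (odd_blocks n X (c div 2))"
      using finite_blocks[OF X] D by simp
    ultimately show ?thesis
      using \<open>odd c \<and> c \<noteq> 1\<close> False by (simp add: card_Diff_subset)
  qed
next
  case False
  then have "{A \<in> blocks n X. block_type A = (c, p)} =
      (if p then {} else {A \<in> blocks n X. card A = c})"
    by (auto simp: block_type_def)
  then show ?thesis using False by (auto simp: Let_def)
qed

lemma fence_iso_of_card_eq:
  assumes X: "X \<subseteq> fence n" and Y: "Y \<subseteq> fence n"
    and size: "\<And>k. 1 \<le> k \<Longrightarrow>
      card {A \<in> blocks n X. card A = k} = card {A \<in> blocks n Y. card A = k}"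
    and odd: "\<And>k. 1 \<le> k \<Longrightarrow> card (odd_blocks n X k) = card (odd_blocks n Y k)"
  shows "\<exists>f. fence_iso X f Y"
proof -
  \<comment> \<open>The hypotheses start at \<open>k = 1\<close>; size \<open>0\<close> is covered
    because blocks are nonempty.\<close>
  have zero: "{A \<in> blocks n Z. card A = 0} = {}" if "Z \<subseteq> fence n" for Z
    using that by (auto elim!: blockE)
  have size': "card {A \<in> blocks n X. card A = c} = card {A \<in> blocks n Y. card A = c}" for c
  proof (cases "c = 0")
    case True
    then show ?thesis by (simp only: zero[OF X] zero[OF Y])
  qed (simp add: size)
  have "card {A \<in> blocks n X. block_type A = v} = card {A \<in> blocks n Y. block_type A = v}" for v
  proof (cases v)
    case (Pair c p)
    \<comment> \<open>An odd \<open>c\<close> other than \<open>1\<close> is at least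
      \<open>3\<close>, so \<open>c div 2\<close> is in the range of the hypothesis on odd
      blocks.\<close>
    have "card (odd_blocks n X (c div 2)) = card (odd_blocks n Y (c div 2))"
      if "odd c" "c \<noteq> 1"
      using that by (intro odd) (auto elim: oddE)
    then show ?thesis
      unfolding Pair card_block_type[OF X] card_block_type[OF Y] Let_def using size' by auto
  qed
  then obtain h where h: "bij_betw h (blocks n X) (blocks n Y)"
    "\<forall>A \<in> blocks n X. block_type (h A) = block_type A"
    using bij_betw_same_type[OF finite_blocks[OF X] finite_blocks[OF Y]] by blast
  have "\<exists>g. fence_iso A g (h A)" if A: "A \<in> blocks n X" for A
  proof -
    obtain i j where ij: "A = {i..j}" "i \<le> j" using X A by (rule blockE)
    have "h A \<in> blocks n Y" using h(1) A by (rule bij_betw_apply)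
    with Y obtain k l where kl: "h A = {k..l}" "k \<le> l" by (rule blockE)
    have "block_type {i..j} = block_type {k..l}" using h(2) A ij(1) kl(1) by metis
    then show ?thesis using fence_iso_intervals ij kl by simp
  qed
  with X Y h(1) show ?thesis by (rule fence_iso_of_block_bijection)
qed

theorem proposition2p3:
  fixes n :: nat and \<alpha> \<beta> :: "nat \<rightharpoonup> nat"
  assumes "1 \<le> n"
    and "\<alpha> \<in> IF_semigroup n"
    and "\<beta> \<in> IF_semigroup n"
  shows "green_J (IF_semigroup n) pmult \<alpha> \<beta> \<longleftrightarrow>
    (\<forall>k::nat. 1 \<le> k \<longrightarrow>
      card (dom_blocks n \<alpha> k) = card (dom_blocks n \<beta> k) \<and>
      card (odd_dom_blocks n \<alpha> k) = card (odd_dom_blocks n \<beta> k))"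
proof -
  have X: "dom \<alpha> \<subseteq> fence n" and Y: "dom \<beta> \<subseteq> fence n"
    using IF_semigroup_subset assms by blast+
  show ?thesis
    \<comment> \<open>Both sides become statements about the two domains alone: isomorphism against
      equality of block counts.\<close>
    unfolding green_J_iff_fence_iso[OF assms(2,3)] dom_blocks_def
      odd_dom_blocks_eq[OF X] odd_dom_blocks_eq[OF Y]
  proof
    assume "\<exists>f. fence_iso (dom \<alpha>) f (dom \<beta>)"
    then obtain f where f: "fence_iso (dom \<alpha>) f (dom \<beta>)" ..
    note g = fence_iso_inv_into[OF f]
    show "\<forall>k\<ge>1.
      card {A \<in> blocks n (dom \<alpha>). card A = k} = card {A \<in> blocks n (dom \<beta>). card A = k} \<and>
      card (odd_blocks n (dom \<alpha>) k) = card (odd_blocks n (dom \<beta>) k)"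
      using fence_iso_card_le[OF f X Y] fence_iso_card_le[OF g Y X] by (simp add: le_antisym)
  qed (use fence_iso_of_card_eq[OF X Y] in blast)
qed

end
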